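(* Let $G$ be a graph, $B$ a PSD forcing set of $G$, $\mathcal F$ a relaxed chronology of PSD forces of $B$ on $G$, $x\in V(G)$, and $\mathcal Q$ the path bundle of $\mathcal F$ induced by $x$. Then $\mathcal Q$ is a rigid linkage of $G$.
   Context: All graphs are finite, simple and undirected. Each vertex is blue or white. PSD rule: if $B$ is the current set of blue vertices, $C$ is a component of $G-B$, and $u\in B$ satisfies $N_G(u)\cap V(C)=\{v\}$, then $u$ can force $v$ to become blue ($u\to v$). $B$ is a PSD forcing set if, starting with exactly $B$ blue, repeated forcing turns all vertices blue. $S_+(G,B)$ is the set of PSD forces $v\to u$ valid when exactly $B$ is blue. Relaxed chronology of PSD forces for a PSD forcing set $B$ on $G$: an ordered family $\mathcal F=\{F^{(k)}\}_{k=1}^K$ of sets of forces ($F^{(k)}=\emptyset$ allowed) such that, with $E_{\mathcal F}^{[0]}=E_{\mathcal F}^{(0)}=B$, $E_{\mathcal F}^{(k)}=\{u: v\to u\in F^{(k)}\text{ for some }v\}$, $E_{\mathcal F}^{[k]}=\bigcup_{j=0}^kE_{\mathcal F}^{(j)}$: (1) $F^{(k)}\subseteq S_+(G,E_{\mathcal F}^{[k-1]})$ for all $k$; (2) $v_1\to u,v_2\to u\in F^{(k)}$ implies $v_1=v_2$; (3) $E_{\mathcal F}^{[K]}=V(G)$. For $x\in V(G)$, $\operatorname{rd}(x)$ is the unique $k$ with $x\in E_{\mathcal F}^{(k)}$. Path bundle of $\mathcal F$ induced by $x$: for $0\le k\le\operatorname{rd}(x)-1$ let $C_x^k$ be the component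 of $G-E_{\mathcal F}^{[k]}$ containing $x$. Let $B=\{v_i^0\}_{i=1}^{|B|}$ and let $Q_i^{[0]}$ be the one-vertex path on $v_i^0$. For each $i$, if $v_i^k\to w\in F^{(k+1)}$ for some $w\in V(C_x^k)$, put $v_i^{k+1}=w$ and obtain $Q_i^{[k+1]}$ by appending $w$ to the end of $Q_i^{[k]}$; otherwise put $v_i^{k+1}=v_i^k$ and $Q_i^{[k+1]}=Q_i^{[k]}$. The induced path bundle is $\mathcal Q=\{Q_i^{[\operatorname{rd}(x)]}\}_{i=1}^{|B|}$, viewed also as the subgraph of $G$ that is the disjoint union of these paths. Rigid linkages: a linkage in $G$ is a subgraph of $G$ whose connected components are paths (single vertices allowed; it need not contain all vertices of $G$). For $\alpha,\beta\subseteq V(G)$, a linkage is an $(\alpha,\beta)$-linkage if $\alpha$ consists of one endpoint of each of its paths and $\beta$ consists of the other endpoint of each path (for a one-vertex path, the vertex is in both $\alpha$ and $\beta$). A linkage $\mathcal P$ is rigid if there exist $\alpha,\beta$ such that $\mathcal P$ is an $(\alpha,\beta)$-linkage and is the unique $(\alpha,\beta)$-linkage in $G$. *)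

theory Defs
  imports "Graph_Theory.Graph_Theory"
begin

text \<open>
  A finite simple undirected graph is a \<^locale>\<open>pair_graph\<close>: a finite loop-free digraph without
  parallel arcs whose arc relation is symmetric, each undirected edge being a pair of opposite
  arcs. In a symmetric digraph the strongly connected components are the connected components.
\<close>

subsection \<open>PSD forcing\<close>

abbreviation delete_verts :: "'a pair_pre_digraph \<Rightarrow> 'a set \<Rightarrow> ('a, 'a \<times> 'a) pre_digraph" where
  "delete_verts G S \<equiv> with_proj G \<restriction> (pverts G - S)"

definition neighbourhood :: "'a pair_pre_digraph \<Rightarrow> 'a \<Rightarrow> 'a set" where
  "neighbourhood G u = {v. (u, v) \<in> parcs G}"

definition psd_forces :: "'a pair_pre_digraph \<Rightarrow> 'a set \<Rightarrow> ('a \<times> 'a) set" where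
  "psd_forces G B = {(u, v). u \<in> B \<and>
     (\<exists>C \<in> pre_digraph.sccs_verts (delete_verts G B). neighbourhood G u \<inter> C = {v})}"

definition psd_step :: "'a pair_pre_digraph \<Rightarrow> 'a set \<Rightarrow> 'a set \<Rightarrow> bool" where
  "psd_step G B B' \<longleftrightarrow> (\<exists>(u, v) \<in> psd_forces G B. B' = insert v B)"

definition psd_forcing_set :: "'a pair_pre_digraph \<Rightarrow> 'a set \<Rightarrow> bool" where
  "psd_forcing_set G B \<longleftrightarrow> B \<subseteq> pverts G \<and> (psd_step G)\<^sup>*\<^sup>* B (pverts G)"


subsection \<open>Relaxed chronologies\<close>

text \<open>
  The ordered family of sets of forces is a function \<open>F\<close> of which only the values at
  \<open>1, \<dots>, K\<close> matter; a force $v \to u$ is the pair \<open>(v, u)\<close>. The sets $E^{(k)}$ and $E^{[k]}$ are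
  \<open>newly_blue B F k\<close> and \<open>expansion B F k\<close>.
\<close>

definition newly_blue :: "'a set \<Rightarrow> (nat \<Rightarrow> ('a \<times> 'a) set) \<Rightarrow> nat \<Rightarrow> 'a set" where
  "newly_blue B F k = (if k = 0 then B else {u. \<exists>v. (v, u) \<in> F k})"

definition expansion :: "'a set \<Rightarrow> (nat \<Rightarrow> ('a \<times> 'a) set) \<Rightarrow> nat \<Rightarrow> 'a set" where
  "expansion B F k = (\<Union>j \<le> k. newly_blue B F j)"

definition relaxed_chronology ::
  "'a pair_pre_digraph \<Rightarrow> 'a set \<Rightarrow> (nat \<Rightarrow> ('a \<times> 'a) set) \<Rightarrow> nat \<Rightarrow> bool" where
  "relaxed_chronology G B F K \<longleftrightarrow>
     (\<forall>k \<in> {1..K}. F k \<subseteq> psd_forces G (expansion B F (k - 1))) \<and>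
     (\<forall>k \<in> {1..K}. \<forall>v\<^sub>1 v\<^sub>2 u. (v\<^sub>1, u) \<in> F k \<and> (v\<^sub>2, u) \<in> F k \<longrightarrow> v\<^sub>1 = v\<^sub>2) \<and>
     expansion B F K = pverts G"

definition round_of :: "'a set \<Rightarrow> (nat \<Rightarrow> ('a \<times> 'a) set) \<Rightarrow> nat \<Rightarrow> 'a \<Rightarrow> nat" where
  "round_of B F K x = (THE k. k \<le> K \<and> x \<in> newly_blue B F k)"


subsection \<open>Path bundles\<close>

text \<open>The vertex set of the component of $G - E^{[k]}$ containing \<open>x\<close>.\<close>

definition white_component ::
  "'a pair_pre_digraph \<Rightarrow> 'a set \<Rightarrow> (nat \<Rightarrow> ('a \<times> 'a) set) \<Rightarrow> 'a \<Rightarrow> nat \<Rightarrow> 'a set" where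
  "white_component G B F x k = pre_digraph.scc_of (delete_verts G (expansion B F k)) x"

text \<open>
  The path starting at $v_i^0$ is indexed by $v_i^0$ itself: for \<open>b = \<close> $v_i^0$,
  \<open>bundle_vertex G B F x b k\<close> is $v_i^k$ and the vertex list \<open>bundle_path G B F x b k\<close>
  is $Q_i^{[k]}$. The vertex \<open>w\<close> is unique, since a force of \<open>u\<close> into a component
  determines the only neighbour of \<open>u\<close> there.
\<close>

primrec bundle_vertex ::
  "'a pair_pre_digraph \<Rightarrow> 'a set \<Rightarrow> (nat \<Rightarrow> ('a \<times> 'a) set) \<Rightarrow> 'a \<Rightarrow> 'a \<Rightarrow> nat \<Rightarrow> 'a" where
  "bundle_vertex G B F x b 0 = b"
| "bundle_vertex G B F x b (Suc k) =
     (if \<exists>w \<in> white_component G B F x k. (bundle_vertex G B F x b k, w) \<in> F (Suc k)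
      then THE w. w \<in> white_component G B F x k \<and> (bundle_vertex G B F x b k, w) \<in> F (Suc k)
      else bundle_vertex G B F x b k)"

primrec bundle_path ::
  "'a pair_pre_digraph \<Rightarrow> 'a set \<Rightarrow> (nat \<Rightarrow> ('a \<times> 'a) set) \<Rightarrow> 'a \<Rightarrow> 'a \<Rightarrow> nat \<Rightarrow> 'a list" where
  "bundle_path G B F x b 0 = [b]"
| "bundle_path G B F x b (Suc k) =
     (if \<exists>w \<in> white_component G B F x k. (bundle_vertex G B F x b k, w) \<in> F (Suc k)
      then bundle_path G B F x b k @ [bundle_vertex G B F x b (Suc k)]
      else bundle_path G B F x b k)"

definition path_bundle ::
  "'a pair_pre_digraph \<Rightarrow> 'a set \<Rightarrow> (nat \<Rightarrow> ('a \<times> 'a) set) \<Rightarrow> nat \<Rightarrow> 'a \<Rightarrow> 'a list set" where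
  "path_bundle G B F K x = (\<lambda>b. bundle_path G B F x b (round_of B F K x)) ` B"


subsection \<open>Rigid linkages\<close>

definition path_graph :: "'a list \<Rightarrow> 'a pair_pre_digraph" where
  "path_graph p =
     \<lparr> pverts = set p, parcs = set (vwalk_arcs p) \<union> (set (vwalk_arcs p))\<inverse> \<rparr>"

definition union_of_paths :: "'a list set \<Rightarrow> 'a pair_pre_digraph" where
  "union_of_paths Q =
     \<lparr> pverts = (\<Union>p \<in> Q. pverts (path_graph p)), parcs = (\<Union>p \<in> Q. parcs (path_graph p)) \<rparr>"

definition path_with_ends :: "('a, 'a \<times> 'a) pre_digraph \<Rightarrow> 'a \<Rightarrow> 'a \<Rightarrow> bool" where
  "path_with_ends C s t \<longleftrightarrow>
     (\<exists>p. p \<noteq> [] \<and> distinct p \<and> hd p = s \<and> last p = t \<and> C = with_proj (path_graph p))"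

definition linkage :: "'a pair_pre_digraph \<Rightarrow> 'a pair_pre_digraph \<Rightarrow> bool" where
  "linkage G P \<longleftrightarrow> pair_graph P \<and> subgraph (with_proj P) (with_proj G) \<and>
     (\<forall>C \<in> pre_digraph.sccs (with_proj P). \<exists>s t. path_with_ends C s t)"

text \<open>
  The functions \<open>s\<close> and \<open>t\<close> choose, separately for each path, which endpoint is put in \<open>\<alpha>\<close>
  and which in \<open>\<beta>\<close>.
\<close>

definition linkage_between ::
  "'a pair_pre_digraph \<Rightarrow> 'a set \<Rightarrow> 'a set \<Rightarrow> 'a pair_pre_digraph \<Rightarrow> bool" where
  "linkage_between G \<alpha> \<beta> P \<longleftrightarrow> linkage G P \<and>
     (\<exists>s t. (\<forall>C \<in> pre_digraph.sccs (with_proj P). path_with_ends C (s C) (t C)) \<and>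
            \<alpha> = s ` pre_digraph.sccs (with_proj P) \<and>
            \<beta> = t ` pre_digraph.sccs (with_proj P))"

definition rigid_linkage :: "'a pair_pre_digraph \<Rightarrow> 'a pair_pre_digraph \<Rightarrow> bool" where
  "rigid_linkage G P \<longleftrightarrow>
     (\<exists>\<alpha> \<beta>. \<alpha> \<subseteq> pverts G \<and> \<beta> \<subseteq> pverts G \<and> linkage_between G \<alpha> \<beta> P \<and>
            (\<forall>P'. linkage_between G \<alpha> \<beta> P' \<longrightarrow> P' = P))"

end

theory Submission
  imports Defs
begin

text \<open>
  The blue vertices adjacent to the white component $C_x^k$ all lie among the current ends $v_i^k$
  of the bundle, and every end that later changes moves into $C_x^k$. Take any linkage from \<open>B\<close>
  to the final ends, and suppose that each of its paths starts with the bundle path $Q_i^{[k]}$.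
  If $v_i^k$ forces \<open>w\<close> in step $k+1$, then the path through $v_i^k$ must still reach a final end
  inside $C_x^k$; it can enter $C_x^k$ only through an end, hence directly from $v_i^k$ since the
  other ends are used by other paths, and \<open>w\<close> is the only neighbour of $v_i^k$ there. So every
  path starts with $Q_i^{[k+1]}$, and at the last step the linkage is the bundle.
\<close>

section \<open>Linkages as families of oriented, pairwise disjoint vertex lists\<close>

definition disjoint_paths :: "'a pair_pre_digraph \<Rightarrow> 'a list set \<Rightarrow> bool" where
  "disjoint_paths G L \<longleftrightarrow>
     pairwise (\<lambda>p q. disjnt (set p) (set q)) L \<and> (\<forall>p \<in> L. vpath p (with_proj G))"

lemma disjoint_pathsD_eq:
  assumes "disjoint_paths G L" "p \<in> L" "q \<in> L" "v \<in> set p" "v \<in> set q"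
  shows "p = q"
  using assms unfolding disjoint_paths_def pairwise_def disjnt_def by blast

lemma disjoint_paths_nonempty: "disjoint_paths G L \<Longrightarrow> p \<in> L \<Longrightarrow> p \<noteq> []"
  and disjoint_paths_distinct: "disjoint_paths G L \<Longrightarrow> p \<in> L \<Longrightarrow> distinct p"
  unfolding disjoint_paths_def vpath_def vwalk_def by auto

lemma vwalk_arcs_in_set: "(u, v) \<in> set (vwalk_arcs p) \<Longrightarrow> u \<in> set p \<and> v \<in> set p"
  by (induct p rule: vwalk_arcs.induct) auto

lemma vwalk_arcs_neq: "distinct p \<Longrightarrow> (u, v) \<in> set (vwalk_arcs p) \<Longrightarrow> u \<noteq> v"
  by (induct p rule: vwalk_arcs.induct) auto

lemma pverts_union_of_paths [simp]: "pverts (union_of_paths L) = \<Union> (set ` L)"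
  by (simp add: union_of_paths_def path_graph_def)

lemma in_parcs_path_graph:
  "(u, v) \<in> parcs (path_graph p) \<longleftrightarrow> (u, v) \<in> set (vwalk_arcs p) \<or> (v, u) \<in> set (vwalk_arcs p)"
  by (simp add: path_graph_def)

lemma in_parcs_union_of_paths:
  "(u, v) \<in> parcs (union_of_paths L) \<longleftrightarrow> (\<exists>p \<in> L. (u, v) \<in> parcs (path_graph p))"
  by (simp add: union_of_paths_def)

lemma in_parcs_path_graphD: "(u, v) \<in> parcs (path_graph p) \<Longrightarrow> u \<in> set p \<and> v \<in> set p"
  by (auto simp: in_parcs_path_graph dest: vwalk_arcs_in_set)

lemma pair_graph_union_of_paths:
  assumes "finite L" "\<And>p. p \<in> L \<Longrightarrow> distinct p"
  shows "pair_graph (union_of_paths L)"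
proof
  fix e assume e: "e \<in> parcs (union_of_paths L)"
  obtain u v where uv: "e = (u, v)" by force
  with e obtain p where p: "p \<in> L" "(u, v) \<in> parcs (path_graph p)"
    by (auto simp: in_parcs_union_of_paths)
  then show "fst e \<in> pverts (union_of_paths L)" "snd e \<in> pverts (union_of_paths L)"
    using uv by (auto dest: in_parcs_path_graphD)
  show "fst e \<noteq> snd e"
    using p uv assms(2) by (auto simp: in_parcs_path_graph dest: vwalk_arcs_neq)
next
  show "finite (pverts (union_of_paths L))" "finite (parcs (union_of_paths L))"
    using assms(1) by (auto simp: union_of_paths_def path_graph_def)
  show "symmetric (with_proj (union_of_paths L))"
    by (auto simp: symmetric_def union_of_paths_def path_graph_def sym_def)
qed

text \<open>The head of a list reaches every vertex along its arcs, and symmetry of the graph then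
  links any two vertices.\<close>

lemma union_of_paths_reachable:
  assumes "finite L" "\<And>p. p \<in> L \<Longrightarrow> distinct p" "p \<in> L" "u \<in> set p" "v \<in> set p"
  shows "u \<rightarrow>\<^sup>*\<^bsub>with_proj (union_of_paths L)\<^esub> v"
proof -
  interpret U: pair_graph "union_of_paths L"
    using assms(1,2) by (rule pair_graph_union_of_paths)
  \<comment> \<open>Stated for every \<open>q\<close> whose vertices and arcs come from
    \<open>p\<close>, so that the induction can pass to tails of \<open>p\<close>.\<close>
  have hd: "hd q \<rightarrow>\<^sup>*\<^bsub>with_proj (union_of_paths L)\<^esub> z"
    if "set q \<subseteq> set p" "set (vwalk_arcs q) \<subseteq> set (vwalk_arcs p)" "z \<in> set q" for q z
    using that
  proof (induct q rule: vwalk_arcs.induct)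
    case (2 a)
    then have "a \<in> pverts (union_of_paths L)" using assms(3) by auto
    with 2 show ?case by (simp add: U.reachable_refl)
  next
    case (3 a b q)
    have "(a, b) \<in> parcs (union_of_paths L)"
      using 3(3) assms(3) by (auto simp: in_parcs_union_of_paths in_parcs_path_graph)
    moreover have "a \<in> pverts (union_of_paths L)"
      using 3(2) assms(3) by auto
    ultimately show ?case
      using 3 U.adj_reachable_trans by (cases "z = a") auto
  qed simp
  from hd[of p u] hd[of p v] assms(4,5) show ?thesis
    using U.symmetric_reachable' U.reachable_trans by blast
qed

text \<open>Each vertex set \<open>set p\<close> is connected, and no arc leaves it because an arc
  of another list would give a shared vertex. These components cover all vertices, so there are no
  others.\<close>

lemma sccs_union_of_paths:
  assumes "finite L" "disjoint_paths G L"
  shows "pre_digraph.sccs (with_proj (union_of_paths L)) = (\<lambda>p. with_proj (path_graph p)) ` L"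
proof -
  let ?U = "union_of_paths L"
  have dist: "\<And>p. p \<in> L \<Longrightarrow> distinct p"
    using assms(2) by (rule disjoint_paths_distinct)
  interpret U: pair_graph ?U
    using assms(1) dist by (rule pair_graph_union_of_paths)
  have arc_same: "v \<in> set p" if "(u, v) \<in> parcs ?U" "p \<in> L" "u \<in> set p" for u v p
    using that disjoint_pathsD_eq[OF assms(2)]
    by (auto simp: in_parcs_union_of_paths dest!: in_parcs_path_graphD)
  have closed: "v \<in> set p" if "u \<rightarrow>\<^sup>*\<^bsub>with_proj ?U\<^esub> v" "p \<in> L" "u \<in> set p" for u v p
    using that by (induct rule: U.reachable_induct) (auto intro: arc_same)
  have "set p \<in> U.sccs_verts" if "p \<in> L" for p
    unfolding U.in_sccs_verts_conv_reachable
    using that closed union_of_paths_reachable[OF assms(1) dist] disjoint_paths_nonempty[OF assms(2)]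
    by (metis (no_types, lifting) set_empty)
  then have "with_proj ?U \<restriction> set p \<in> U.sccs" if "p \<in> L" for p
    using that by (simp add: U.in_sccs_verts_conv)
  \<comment> \<open>Restricting to \<open>set p\<close> adds no arcs: an arc with both ends in
    \<open>set p\<close> stems from a list meeting \<open>p\<close>, which is \<open>p\<close>
    itself.\<close>
  moreover have "with_proj ?U \<restriction> set p = with_proj (path_graph p)" if "p \<in> L" for p
  proof -
    have "{e \<in> parcs ?U. fst e \<in> set p \<and> snd e \<in> set p} = parcs (path_graph p)"
      using that disjoint_pathsD_eq[OF assms(2)]
      by (fastforce simp: in_parcs_union_of_paths dest: in_parcs_path_graphD)
    then show ?thesis
      by (simp add: induce_subgraph_def with_proj_def path_graph_def)
  qed
  ultimately have sub: "(\<lambda>p. with_proj (path_graph p)) ` L \<subseteq> U.sccs"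
    by (metis image_subsetI)
  have vs: "verts (U.Union ((\<lambda>p. with_proj (path_graph p)) ` L)) = pverts ?U"
    by (simp add: U.Union_def path_graph_def)
  show ?thesis
    by (rule U.scc_decomp_unique[OF sub vs, symmetric])
qed

text \<open>A longer list and its reverse have the same graph; disjointness is what excludes such
  pairs. Injectivity lets a component determine its oriented list.\<close>

lemma inj_on_path_graph:
  assumes "disjoint_paths G L"
  shows "inj_on (\<lambda>p. with_proj (path_graph p)) L"
proof (rule inj_onI)
  fix p q assume pq: "p \<in> L" "q \<in> L" "with_proj (path_graph p) = with_proj (path_graph q)"
  then have "set p = set q"
    by (simp add: with_proj_def path_graph_def)
  moreover have "hd p \<in> set p"
    using disjoint_paths_nonempty[OF assms pq(1)] by simp
  ultimately show "p = q"
    using pq disjoint_pathsD_eq[OF assms] by blast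
qed

lemma subgraph_union_of_paths:
  assumes "pair_graph G" "finite L" "disjoint_paths G L"
  shows "subgraph (with_proj (union_of_paths L)) (with_proj G)"
proof -
  interpret G: pair_graph G by fact
  interpret U: pair_graph "union_of_paths L"
    using assms(2) disjoint_paths_distinct[OF assms(3)] by (rule pair_graph_union_of_paths)
  have "set p \<subseteq> pverts G" "set (vwalk_arcs p) \<subseteq> parcs G" if "p \<in> L" for p
    using assms(3) that by (auto simp: disjoint_paths_def vpath_def vwalk_def)
  then show ?thesis
    using G.arcs_symmetric G.wf_digraph U.wf_digraph
    by (intro subgraphI) (auto simp: union_of_paths_def path_graph_def; blast)+
qed

lemma linkage_between_union_of_paths:
  assumes "pair_graph G" "finite L" "disjoint_paths G L"
  shows "linkage_between G (hd ` L) (last ` L) (union_of_paths L)"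
proof -
  let ?g = "\<lambda>p. with_proj (path_graph p)"
  \<comment> \<open>Recovers the list from its component; \<open>hd\<close> and \<open>last\<close>
    of this list serve as the endpoint choices \<open>s\<close> and \<open>t\<close>.\<close>
  let ?i = "inv_into L ?g"
  have inv: "?i (?g p) = p" if "p \<in> L" for p
    using inj_on_path_graph[OF assms(3)] that by (rule inv_into_f_f)
  have ends: "path_with_ends (?g p) (hd p) (last p)" if "p \<in> L" for p
    using that disjoint_paths_nonempty[OF assms(3)] disjoint_paths_distinct[OF assms(3)]
    unfolding path_with_ends_def by blast
  have "linkage G (union_of_paths L)"
    unfolding linkage_def sccs_union_of_paths[OF assms(2,3)]
    using pair_graph_union_of_paths[OF assms(2) disjoint_paths_distinct[OF assms(3)]]
      subgraph_union_of_paths[OF assms] ends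
    by blast
  moreover have "hd ` L = (\<lambda>C. hd (?i C)) ` ?g ` L" "last ` L = (\<lambda>C. last (?i C)) ` ?g ` L"
    using inv by (force simp: image_iff)+
  ultimately show ?thesis
    unfolding linkage_between_def sccs_union_of_paths[OF assms(2,3)]
    using inv ends by (intro conjI exI[of _ "\<lambda>C. hd (?i C)"] exI[of _ "\<lambda>C. last (?i C)"]) auto
qed

text \<open>Converse passage: orienting each component from its end in \<alpha> to its end in
  \<beta> turns an arbitrary linkage into lists, so uniqueness need only be shown for families of
  lists.\<close>

lemma linkage_betweenE:
  assumes "linkage_between G \<alpha> \<beta> P"
  obtains L where "disjoint_paths G L" "\<alpha> = hd ` L" "\<beta> = last ` L" "P = union_of_paths L"
proof -
  interpret P: pair_graph P
    using assms by (simp add: linkage_between_def linkage_def)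
  have sub: "subgraph (with_proj P) (with_proj G)"
    using assms by (simp add: linkage_between_def linkage_def)
  obtain s t where st: "\<forall>C \<in> P.sccs. path_with_ends C (s C) (t C)"
    and \<alpha>: "\<alpha> = s ` P.sccs" and \<beta>: "\<beta> = t ` P.sccs"
    using assms by (auto simp: linkage_between_def)
  then obtain p where p: "\<And>C. C \<in> P.sccs \<Longrightarrow> p C \<noteq> [] \<and> distinct (p C) \<and> hd (p C) = s C \<and>
      last (p C) = t C \<and> C = with_proj (path_graph (p C))"
    unfolding path_with_ends_def by metis
  have vs: "verts C = set (p C)" "arcs C = parcs (path_graph (p C))" if "C \<in> P.sccs" for C
  proof -
    have "verts C = pverts (path_graph (p C))"
      using p[OF that] with_proj_simps(1) by metis
    then show "verts C = set (p C)"
      by (simp add: path_graph_def)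
    show "arcs C = parcs (path_graph (p C))"
      using p[OF that] with_proj_simps(2) by metis
  qed
  show thesis
  proof
    show "disjoint_paths G (p ` P.sccs)"
      unfolding disjoint_paths_def
    proof (intro conjI ballI)
      show "pairwise (\<lambda>p q. disjnt (set p) (set q)) (p ` P.sccs)"
        using P.scc_disj vs by (auto simp: pairwise_def disjnt_def)
      fix q assume "q \<in> p ` P.sccs"
      then obtain C where C: "C \<in> P.sccs" "q = p C" by auto
      have "subgraph C (with_proj P)"
        using C(1) by (auto dest: P.in_sccs_imp_induced)
      then have "subgraph C (with_proj G)"
        using sub by (rule subgraph_trans)
      then have "verts C \<subseteq> pverts G" "arcs C \<subseteq> parcs G"
        by (simp_all add: subgraph_def)
      then show "vpath q (with_proj G)"
        using C p[OF C(1)] vs[OF C(1)] by (auto simp: vpath_def vwalk_def path_graph_def)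
    qed
    show "\<alpha> = hd ` p ` P.sccs" "\<beta> = last ` p ` P.sccs"
      using \<alpha> \<beta> p by (simp_all add: image_image)
    have "(\<Union>C \<in> P.sccs. verts C) = pverts P" "(\<Union>C \<in> P.sccs. arcs C) = parcs P"
      using arg_cong[OF P.graph_is_union_sccs, of verts] arg_cong[OF P.graph_is_union_sccs, of arcs]
      by (simp_all add: P.Union_def)
    then show "P = union_of_paths (p ` P.sccs)"
      using vs by (simp add: union_of_paths_def path_graph_def)
  qed
qed


section \<open>White components in a relaxed chronology and valid forces\<close>

lemma (in pair_graph) sym_digraph_delete_verts: "sym_digraph (delete_verts G S)"
proof -
  interpret D: wf_digraph "delete_verts G S"
    by (rule wellformed_induce_subgraph)
  show ?thesis
    using arcs_symmetric by unfold_locales (auto simp: symmetric_def sym_def arcs_ends_conv image_iff)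
qed

locale psd_chronology = pair_graph G for G :: "'a pair_pre_digraph" +
  fixes B :: "'a set" and F :: "nat \<Rightarrow> ('a \<times> 'a) set" and K :: nat and x :: 'a
  assumes chronology: "relaxed_chronology G B F K"
begin

abbreviation blue :: "nat \<Rightarrow> 'a set" where
  "blue \<equiv> expansion B F"

abbreviation white :: "nat \<Rightarrow> 'a set" where
  "white \<equiv> white_component G B F x"

abbreviation tip :: "'a \<Rightarrow> nat \<Rightarrow> 'a" where
  "tip \<equiv> bundle_vertex G B F x"

abbreviation bpath :: "'a \<Rightarrow> nat \<Rightarrow> 'a list" where
  "bpath \<equiv> bundle_path G B F x"

lemma blue_0: "blue 0 = B"
  by (simp add: expansion_def newly_blue_def)

lemma blue_Suc: "blue (Suc k) = blue k \<union> snd ` F (Suc k)"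
  by (force simp: expansion_def newly_blue_def atMost_Suc)

lemma blue_mono: "j \<le> k \<Longrightarrow> blue j \<subseteq> blue k"
  by (auto simp: expansion_def) (meson atMost_iff order_trans)

lemma newly_blue_subset: "newly_blue B F k \<subseteq> blue k"
  by (auto simp: expansion_def)

lemma blue_subset: "k \<le> K \<Longrightarrow> blue k \<subseteq> pverts G"
  using chronology blue_mono[of k K] by (simp add: relaxed_chronology_def)

lemma B_subset: "B \<subseteq> pverts G"
  using blue_subset[of 0] by (simp add: blue_0)

text \<open>Symmetry reduces mutual reachability to one direction. Once \<open>x\<close> is blue,
  both sides are false, as reachability requires its ends to be vertices; so \<open>white k\<close>
  is then empty and no case split on \<open>x\<close> is needed later.\<close>

lemma white_eq: "y \<in> white k \<longleftrightarrow> x \<rightarrow>\<^sup>*\<^bsub>delete_verts G (blue k)\<^esub> y"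
proof -
  interpret D: sym_digraph "delete_verts G (blue k)"
    by (rule sym_digraph_delete_verts)
  show ?thesis
    by (auto simp: white_component_def D.scc_of_def dest: D.symmetric_reachable')
qed

lemma white_not_blue: "y \<in> white k \<Longrightarrow> y \<in> pverts G - blue k"
  by (auto simp: white_eq elim: reachable_in_vertsE)

lemma white_closed:
  assumes "y \<in> white k" "(y, z) \<in> parcs G" "z \<notin> blue k"
  shows "z \<in> white k"
proof -
  interpret D: sym_digraph "delete_verts G (blue k)"
    by (rule sym_digraph_delete_verts)
  have "y \<rightarrow>\<^bsub>delete_verts G (blue k)\<^esub> z"
    using white_not_blue[OF assms(1)] assms(2,3) in_arcsD2 by (auto simp: arcs_ends_conv image_iff)
  then show ?thesis
    using assms(1) D.reachable_adj_trans by (auto simp: white_eq)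
qed

text \<open>Blue sets grow, so a walk from \<open>x\<close> avoiding \<open>blue k\<close> also
  avoids \<open>blue j\<close>.\<close>

lemma white_antimono: "j \<le> k \<Longrightarrow> white k \<subseteq> white j"
proof
  fix y assume "j \<le> k" "y \<in> white k"
  moreover have "arcs_ends (delete_verts G (blue k)) \<subseteq> arcs_ends (delete_verts G (blue j))"
    using blue_mono[OF \<open>j \<le> k\<close>] by (auto simp: arcs_ends_conv)
  ultimately show "y \<in> white j"
    using blue_mono[of j k] unfolding white_eq reachable_def
    by (auto elim!: rtrancl_on_mono[rotated 2])
qed

text \<open>Identifies the anonymous component in the definition of a PSD force with
  \<open>white k\<close> as soon as they meet, since components are disjoint.\<close>

lemma white_eq_scc:
  assumes "C \<in> pre_digraph.sccs_verts (delete_verts G (blue k))" "y \<in> C" "y \<in> white k"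
  shows "C = white k"
proof -
  interpret D: sym_digraph "delete_verts G (blue k)"
    by (rule sym_digraph_delete_verts)
  have "white k \<in> D.sccs_verts"
    using assms(3) unfolding white_component_def
    by (metis D.scc_of_empty_conv D.scc_of_in_sccs_verts empty_iff)
  with assms show ?thesis
    using D.sccs_verts_disjoint by blast
qed

lemma valid_force:
  assumes "Suc k \<le> K" "(u, w) \<in> F (Suc k)"
  shows "u \<in> blue k" "w \<notin> blue k" "(u, w) \<in> parcs G" "w \<in> blue (Suc k)"
    and "w \<in> white k \<Longrightarrow> (u, y) \<in> parcs G \<Longrightarrow> y \<in> white k \<Longrightarrow> y = w"
    and "(u', w) \<in> F (Suc k) \<Longrightarrow> u' = u"
proof -
  interpret D: sym_digraph "delete_verts G (blue k)"
    by (rule sym_digraph_delete_verts)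
  \<comment> \<open>Writing the round as \<open>Suc k\<close> turns the index \<open>k - 1\<close>
    of the chronology into plain \<open>k\<close>.\<close>
  have "F (Suc k) \<subseteq> psd_forces G (blue k)"
    using chronology assms(1) unfolding relaxed_chronology_def
    by (metis One_nat_def Suc_le_mono atLeastAtMost_iff diff_Suc_1 le0)
  with assms(2) obtain C where C: "u \<in> blue k" "C \<in> D.sccs_verts" "neighbourhood G u \<inter> C = {w}"
    by (auto simp: psd_forces_def)
  then show "u \<in> blue k" "w \<notin> blue k" "(u, w) \<in> parcs G"
    using D.sccs_verts_subsets[OF C(2)] by (auto simp: neighbourhood_def)
  show "w \<in> blue (Suc k)"
    using assms(2) by (force simp: blue_Suc)
  show "y = w" if "w \<in> white k" "(u, y) \<in> parcs G" "y \<in> white k"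
    using white_eq_scc[OF C(2) _ that(1)] C(3) that(2,3) by (auto simp: neighbourhood_def)
  show "u' = u" if "(u', w) \<in> F (Suc k)"
    using chronology assms that unfolding relaxed_chronology_def
    by (metis One_nat_def Suc_le_mono atLeastAtMost_iff le0)
qed

section \<open>The bundle paths and their current ends\<close>

text \<open>The description by \<open>THE\<close> is meaningful because a forced vertex in
  \<open>white k\<close> is the only neighbour of its forcer there. This case rule replaces the
  recursive equations from here on.\<close>

lemma bundle_step:
  assumes "Suc k \<le> K"
  obtains (force) w where "w \<in> white k" "(tip b k, w) \<in> F (Suc k)"
      "tip b (Suc k) = w" "bpath b (Suc k) = bpath b k @ [w]"
  | (stay) "\<And>w. w \<in> white k \<Longrightarrow> (tip b k, w) \<notin> F (Suc k)"
      "tip b (Suc k) = tip b k" "bpath b (Suc k) = bpath b k"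
proof (cases "\<exists>w \<in> white k. (tip b k, w) \<in> F (Suc k)")
  case True
  then obtain w where w: "w \<in> white k" "(tip b k, w) \<in> F (Suc k)" by blast
  then have "(THE w. w \<in> white k \<and> (tip b k, w) \<in> F (Suc k)) = w"
    using valid_force(3,5)[OF assms] by (intro the_equality) blast+
  then have "tip b (Suc k) = w" using True by simp
  with w True show thesis by (intro that(1)) auto
next
  case False
  then show thesis by (intro that(2)) auto
qed

declare bundle_vertex.simps(2) [simp del] bundle_path.simps(2) [simp del]

lemma bpath_ends:
  assumes "k \<le> K"
  shows "bpath b k \<noteq> [] \<and> hd (bpath b k) = b \<and> last (bpath b k) = tip b k"
  using assms
proof (induct k)
  case (Suc k)
  show ?case
    using Suc.prems by (cases rule: bundle_step[of k b]) (use Suc in auto)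
qed simp

lemma bpath_blue:
  assumes "k \<le> K" "b \<in> B"
  shows "set (bpath b k) \<subseteq> blue k"
  using assms
proof (induct k)
  case (Suc k)
  have "blue k \<subseteq> blue (Suc k)" by (simp add: blue_mono)
  with Suc.prems(1) show ?case
    by (cases rule: bundle_step[of k b]) (use Suc valid_force(4) in auto)
qed (simp add: blue_0)

lemma tip_blue: "k \<le> K \<Longrightarrow> b \<in> B \<Longrightarrow> tip b k \<in> blue k"
  using bpath_blue bpath_ends last_in_set by (metis subsetD)

text \<open>An appended vertex is a neighbour of the old end and was not yet blue, whereas the path
  so far is blue; hence no vertex repeats.\<close>

lemma vpath_bpath:
  assumes "k \<le> K" "b \<in> B"
  shows "vpath (bpath b k) (with_proj G)"
  using assms
proof (induct k)
  case 0
  then show ?case using B_subset by (auto simp: vpath_def vwalk_def)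
next
  case (Suc k)
  show ?case
    using Suc.prems(1)
  proof (cases rule: bundle_step[of k b])
    case (force w)
    have "(tip b k, w) \<in> parcs G" "w \<notin> set (bpath b k)"
      using force(2) valid_force(2,3) Suc.prems bpath_blue[of k b]
      by auto
    then show ?thesis
      using Suc force(4) bpath_ends[of k b] in_arcsD2
      by (auto simp: vpath_def vwalk_def vwalk_arcs_append)
  qed (use Suc in auto)
qed

text \<open>An appended vertex was not blue, so it lies on no earlier path; and it is not appended
  to two paths at once, since their ends differ and a vertex has only one forcer per round.\<close>

lemma bpath_disjnt:
  assumes "k \<le> K" "b \<in> B" "c \<in> B" "b \<noteq> c"
  shows "disjnt (set (bpath b k)) (set (bpath c k))"
  using assms(1)
proof (induct k)
  case 0
  then show ?case using assms(4) by simp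
next
  case (Suc k)
  have IH: "disjnt (set (bpath b k)) (set (bpath c k))"
    using Suc by simp
  have new: "w \<notin> set (bpath d k)" if "(u, w) \<in> F (Suc k)" "d \<in> B" for u w d
    using valid_force(2)[OF Suc.prems that(1)] bpath_blue[of k d] that(2) Suc.prems by auto
  have "tip b k \<noteq> tip c k"
    using IH bpath_ends[of k b] bpath_ends[of k c] Suc.prems last_in_set
    by (metis Suc_leD disjnt_iff)
  then have new2: "(tip c k, w) \<notin> F (Suc k)" if "(tip b k, w) \<in> F (Suc k)" for w
    using valid_force(6)[OF Suc.prems] that by blast
  show ?case
    using Suc.prems
    by (cases rule: bundle_step[of k b]; cases rule: bundle_step[OF Suc.prems, of c])
       (use IH new new2 assms(2,3) in \<open>auto simp: disjnt_iff\<close>)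
qed

text \<open>The key invariant: a blue vertex that still sees the component of \<open>x\<close> is
  the end of some bundle path. Each round either leaves such an end in place or moves an end onto
  the new boundary vertex.\<close>

lemma white_boundary:
  assumes "k \<le> K" "u \<in> blue k" "y \<in> white k" "(u, y) \<in> parcs G"
  shows "u \<in> (\<lambda>b. tip b k) ` B"
  using assms
proof (induct k arbitrary: u y)
  case 0
  then show ?case by (simp add: blue_0)
next
  case (Suc k)
  have k: "Suc k \<le> K" "k \<le> K" using Suc.prems(1) by auto
  have y: "y \<in> white k" using white_antimono[of k "Suc k"] Suc.prems(3) by auto
  show ?case
  proof (cases "u \<in> blue k")
    case True
    then obtain b where b: "b \<in> B" "u = tip b k"
      using Suc.hyps[OF k(2)] y Suc.prems(4) by blast
    \<comment> \<open>If this end forced into \<open>white k\<close>, it would force its only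
      neighbour there, namely \<open>y\<close>; but \<open>y\<close> is still white after the
      round.\<close>
    from k(1) have "tip b (Suc k) = tip b k"
    proof (cases rule: bundle_step[of k b])
      case (force w)
      then have "y = w"
        using valid_force(5)[OF k(1), of u w y] b(2) y Suc.prems(4)
        by simp
      then have False
        using valid_force(4)[OF k(1) force(2)]
          white_not_blue[OF Suc.prems(3)] by simp
      then show ?thesis ..
    qed
    with b show ?thesis by (metis imageI)
  next
    case False
    then obtain v where v: "(v, u) \<in> F (Suc k)"
      using Suc.prems(2) by (auto simp: blue_Suc)
    \<comment> \<open>\<open>u\<close> was white and adjacent to \<open>y\<close>, so it lay in the
      old component. Its forcer was therefore on the old boundary, hence an end, and that end moves
      to \<open>u\<close>.\<close>
    have u: "u \<in> white k"
      using white_closed[OF y _ False] Suc.prems(4) arcs_symmetric by blast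
    then obtain b where b: "b \<in> B" "v = tip b k"
      using Suc.hyps[OF k(2)] valid_force(1,3)[OF k(1) v] by blast
    from k(1) have "tip b (Suc k) = u"
    proof (cases rule: bundle_step[of k b])
      case (force w)
      then show ?thesis
        using valid_force(3,5)[OF k(1)] u v b(2) by blast
    next
      case stay
      then show ?thesis using u v b(2) by blast
    qed
    with b show ?thesis by (metis imageI)
  qed
qed

section \<open>Linkages from \<open>B\<close> to the final ends\<close>

text \<open>Every move after round \<open>k\<close> lands in some \<open>white j\<close>, which is
  contained in \<open>white k\<close>.\<close>

lemma tip_later:
  assumes "k \<le> j" "j \<le> K"
  shows "tip b j = tip b k \<or> tip b j \<in> white k"
  using assms
proof (induct j rule: dec_induct)
  case (step j)
  have "white j \<subseteq> white k" using step by (simp add: white_antimono)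
  with step.prems show ?case
    by (cases rule: bundle_step[of j b]) (use step in auto)
qed simp

text \<open>An end never returns to a vertex it has left: that vertex is blue, and later moves land
  in white components.\<close>

lemma tip_forcing_moves:
  assumes "k < m" "m \<le> K" "b \<in> B" "w \<in> white k" "(tip b k, w) \<in> F (Suc k)"
  shows "tip b m \<noteq> tip b k"
proof -
  have k: "Suc k \<le> K" using assms by simp
  from k have w: "tip b (Suc k) = w"
    by (cases rule: bundle_step[of k b]) (use assms(4,5) valid_force(3,5)[OF k] in blast)+
  moreover have "w \<noteq> tip b k"
    using valid_force(1,2)[OF k assms(5)] by auto
  moreover have "tip b k \<notin> white (Suc k)"
    using white_antimono[of k "Suc k"] white_not_blue valid_force(1)[OF k assms(5)] by auto
  moreover have "tip b m = tip b (Suc k) \<or> tip b m \<in> white (Suc k)"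
    using assms(1,2) by (intro tip_later) auto
  ultimately show ?thesis by auto
qed

text \<open>The induction treats all members of \<open>L\<close> together, because extending one
  path uses that the other paths already occupy the other ends.\<close>

lemma bpath_prefix_of_linkage:
  assumes L: "disjoint_paths G L" and ends: "hd ` L = B" "last ` L = (\<lambda>b. tip b m) ` B"
    and m: "k \<le> m" "m \<le> K"
  shows "\<And>p. p \<in> L \<Longrightarrow> \<exists>r. p = bpath (hd p) k @ r"
  using m(1)
proof (induct k)
  case 0
  then show ?case
    using disjoint_paths_nonempty[OF L] by (metis append_Cons append_Nil bundle_path.simps(1) list.collapse)
next
  case (Suc k p)
  have kK: "Suc k \<le> K" "k \<le> K" "k \<le> m" using Suc.prems m by auto
  define b where "b = hd p"
  have b: "b \<in> B" using Suc.prems(1) ends(1) b_def by auto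
  obtain r where r: "p = bpath b k @ r"
    using Suc.hyps[OF Suc.prems(1) kK(3)] b_def by auto
  \<comment> \<open>By induction the member of \<open>L\<close> starting at \<open>c\<close>
    contains \<open>tip c k\<close>, so disjointness makes it \<open>p\<close>.\<close>
  have tip_same: "c = b" if h: "c \<in> B" "tip c k \<in> set p" for c
  proof -
    obtain q where q: "q \<in> L" "hd q = c" using h(1) ends(1) by auto
    then have "tip c k \<in> set q"
      using Suc.hyps[OF q(1) kK(3)] bpath_ends[OF kK(2), of c] last_in_set
      by (metis UnCI set_append)
    then have "q = p"
      using disjoint_pathsD_eq[OF L q(1) Suc.prems(1)] h(2) by blast
    then show ?thesis
      using q(2) b_def by simp
  qed
  from kK(1) have "\<exists>r. p = bpath b (Suc k) @ r"
  proof (cases rule: bundle_step[of k b])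
    case stay
    then show ?thesis using r by auto
  next
    case (force w)
    \<comment> \<open>Only the sets of ends are prescribed, so \<open>p\<close> may a priori finish
      at the end belonging to another start \<open>c\<close>.\<close>
    obtain c where c: "c \<in> B" "last p = tip c m"
      using ends(2) Suc.prems(1) by (metis (no_types, lifting) image_iff)
    have "p \<noteq> []" using disjoint_paths_nonempty[OF L Suc.prems(1)] .
    have moved: "tip b m \<noteq> tip b k"
      using tip_forcing_moves[of k m b w] Suc.prems m(2) b force by simp
    \<comment> \<open>Otherwise the end of \<open>c\<close> has not moved since round
      \<open>k\<close>, so it is \<open>tip c k\<close> on \<open>p\<close> and
      \<open>c = b\<close>; but the end of \<open>b\<close> does move.\<close>
    have last: "last p \<in> white k"
    proof (rule ccontr)
      assume "last p \<notin> white k"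
      then have "tip c m = tip c k"
        using tip_later[OF kK(3) m(2), of c] c(2) by auto
      moreover from this have "c = b"
        using tip_same c \<open>p \<noteq> []\<close> last_in_set by metis
      ultimately show False using moved by simp
    qed
    have "tip b k \<in> blue k" using tip_blue[OF kK(2) b] .
    then have "r \<noteq> []"
      using last r bpath_ends[OF kK(2), of b] white_not_blue by auto
    have walk: "set (vwalk_arcs p) \<subseteq> parcs G" "distinct p"
      using L Suc.prems(1) by (auto simp: disjoint_paths_def vpath_def vwalk_def)
    \<comment> \<open>Backwards from \<open>last p\<close>: a blue vertex just before a vertex of
      \<open>white k\<close> would be an end, hence \<open>tip b k\<close>, which \<open>p\<close>
      has already visited.\<close>
    have inside: "hd s \<in> white k" if "r = t @ s" "s \<noteq> []" for s t
      using that
    proof (induct s arbitrary: t)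
      case (Cons a s)
      show ?case
      proof (cases "s = []")
        case True
        then show ?thesis using last r Cons by simp
      next
        case False
        have next_in: "hd s \<in> white k"
          using Cons.hyps[of "t @ [a]"] Cons.prems False by simp
        have "p = (bpath b k @ t) @ (a # s)"
          using r Cons.prems by simp
        then have "set (vwalk_arcs (a # s)) \<subseteq> parcs G"
          using walk(1) set_vwalk_arcs_append2 by blast
        then have arc: "(a, hd s) \<in> parcs G"
          using False by simp
        have "a \<notin> blue k"
        proof
          assume "a \<in> blue k"
          then obtain d where d: "d \<in> B" "a = tip d k"
            using white_boundary[OF kK(2) _ next_in arc] by auto
          then have "a = tip b k"
            using tip_same[of d] r Cons.prems by auto
          then have "a \<in> set (bpath b k)"
            using bpath_ends[OF kK(2), of b] last_in_set by metis
          then show False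
            using walk(2) r Cons.prems by auto
        qed
        then show ?thesis
          using white_closed[OF next_in] arc arcs_symmetric by simp
      qed
    qed simp
    \<comment> \<open>The path steps from \<open>tip b k\<close> straight into
      \<open>white k\<close>, where \<open>w\<close> is the only available neighbour.\<close>
    have "(tip b k, hd r) \<in> parcs G"
      using walk(1) r \<open>r \<noteq> []\<close> bpath_ends[OF kK(2), of b] by (simp add: vwalk_arcs_append)
    then have "hd r = w"
      using valid_force(5)[OF kK(1) force(2,1)]
        inside[of "[]" r] \<open>r \<noteq> []\<close> by simp
    then have "p = bpath b (Suc k) @ tl r"
      using r force(4) \<open>r \<noteq> []\<close> by (cases r) auto
    then show ?thesis ..
  qed
  then show ?case by (simp add: b_def)
qed

section \<open>Uniqueness and rigidity of the bundle\<close>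

lemma disjoint_paths_bundle:
  assumes "m \<le> K"
  shows "disjoint_paths G ((\<lambda>b. bpath b m) ` B)"
  using bpath_disjnt[OF assms] vpath_bpath[OF assms]
  by (auto simp: disjoint_paths_def pairwise_def)

text \<open>Each member starts with its full bundle path; it remains to exclude a continuation
  \<open>r\<close> beyond the final end.\<close>

lemma linkage_unique:
  assumes L: "disjoint_paths G L" and ends: "hd ` L = B" "last ` L = (\<lambda>b. tip b m) ` B"
    and m: "m \<le> K"
  shows "L = (\<lambda>b. bpath b m) ` B"
proof -
  have pre: "\<exists>r. p = bpath (hd p) m @ r" if "p \<in> L" for p
    using bpath_prefix_of_linkage[OF L ends order_refl m that] .
  have tip_in: "tip (hd p) m \<in> set p" if "p \<in> L" for p
    using pre[OF that] bpath_ends[OF m, of "hd p"] last_in_set by (metis UnCI set_append)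
  have eq: "p = bpath (hd p) m" if p: "p \<in> L" for p
  proof -
    have "tip (hd p) m \<in> last ` L" using ends p by auto
    then obtain q where q: "q \<in> L" "last q = tip (hd p) m" by (metis (no_types, lifting) imageE)
    \<comment> \<open>The final end on \<open>p\<close> is the last vertex of some member, which by
      disjointness is \<open>p\<close>; so \<open>p\<close> stops there.\<close>
    then have "q = p"
      using disjoint_pathsD_eq[OF L q(1) p] tip_in[OF p] disjoint_paths_nonempty[OF L q(1)]
      by (metis last_in_set)
    obtain r where r: "p = bpath (hd p) m @ r" using pre[OF p] ..
    have "r = []"
    proof (rule ccontr)
      assume "r \<noteq> []"
      then have "last p \<in> set r" using r by (metis last_appendR last_in_set)
      moreover have "last p \<in> set (bpath (hd p) m)"
        using q(2) \<open>q = p\<close> bpath_ends[OF m, of "hd p"] last_in_set by metis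
      ultimately show False
        using r disjoint_paths_distinct[OF L p] by (metis disjoint_iff distinct_append)
    qed
    with r show ?thesis by simp
  qed
  then have "L = (\<lambda>p. bpath (hd p) m) ` L" by force
  also have "\<dots> = (\<lambda>b. bpath b m) ` hd ` L" by (simp add: image_image)
  finally show ?thesis by (simp add: ends(1))
qed

text \<open>The witnesses are \<alpha> = \<open>B\<close> and \<beta> the set of ends after round
  \<open>m\<close>. Every truncation with \<open>m \<le> K\<close> is rigid, not only the one at the
  round of \<open>x\<close>.\<close>

lemma rigid_linkage_bundle:
  assumes m: "m \<le> K"
  shows "rigid_linkage G (union_of_paths ((\<lambda>b. bpath b m) ` B))"
proof -
  let ?Q = "(\<lambda>b. bpath b m) ` B" and ?\<beta> = "(\<lambda>b. tip b m) ` B"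
  have "finite B"
    using B_subset pair_finite_verts by (rule finite_subset)
  moreover have ends: "hd ` ?Q = B" "last ` ?Q = ?\<beta>"
    using bpath_ends[OF m] by (auto simp: image_image)
  ultimately have "linkage_between G B ?\<beta> (union_of_paths ?Q)"
    using linkage_between_union_of_paths[OF pair_graph _ disjoint_paths_bundle[OF m]] by simp
  moreover have "P = union_of_paths ?Q" if "linkage_between G B ?\<beta> P" for P
    using that by (rule linkage_betweenE) (use linkage_unique[OF _ _ _ m] in metis)
  moreover have "?\<beta> \<subseteq> pverts G"
    using tip_blue[OF m] blue_subset[OF m] by auto
  ultimately show ?thesis
    using B_subset unfolding rigid_linkage_def by blast
qed

text \<open>A vertex forced in a round was not blue before it. This justifies the \<open>THE\<close>
  in \<open>round_of\<close>.\<close>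

lemma newly_blue_unique:
  assumes "i \<le> K" "j \<le> K" "y \<in> newly_blue B F i" "y \<in> newly_blue B F j"
  shows "i = j"
proof -
  have "\<not> i < j" if h: "j \<le> K" "y \<in> newly_blue B F i" "y \<in> newly_blue B F j" for i j
  proof
    assume "i < j"
    then obtain k where k: "j = Suc k" "i \<le> k" by (cases j) auto
    then obtain v where "(v, y) \<in> F (Suc k)" using h(3) by (auto simp: newly_blue_def)
    then have "y \<notin> blue k" using valid_force(2) h(1) k(1) by blast
    then show False using h(2) newly_blue_subset[of i] blue_mono[OF k(2)] by auto
  qed
  then show ?thesis using assms by (meson linorder_neqE_nat)
qed

lemma round_of_le: "x \<in> pverts G \<Longrightarrow> round_of B F K x \<le> K"
proof -
  assume "x \<in> pverts G"
  then have "x \<in> blue K" using chronology by (simp add: relaxed_chronology_def)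
  then obtain k where "k \<le> K" "x \<in> newly_blue B F k" by (auto simp: expansion_def)
  then have "\<exists>!k. k \<le> K \<and> x \<in> newly_blue B F k"
    using newly_blue_unique by blast
  then show ?thesis using theI'[of "\<lambda>k. k \<le> K \<and> x \<in> newly_blue B F k"] by (simp add: round_of_def)
qed

end

text \<open>Disjointness is stated separately because \<open>union_of_paths\<close> would merge
  lists sharing a vertex; with it, the union is a disjoint one.\<close>

theorem theoremB4:
  fixes G :: "'a pair_pre_digraph" and B :: "'a set"
    and F :: "nat \<Rightarrow> ('a \<times> 'a) set" and K :: nat and x :: 'a
  assumes "pair_graph G"
    and "psd_forcing_set G B"
    and "relaxed_chronology G B F K"
    and "x \<in> pverts G"
  shows "pairwise (\<lambda>p q. disjnt (set p) (set q)) (path_bundle G B F K x) \<and>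
         rigid_linkage G (union_of_paths (path_bundle G B F K x))"
proof -
  interpret pair_graph G by fact
  interpret psd_chronology G B F K x
    by unfold_locales fact
  show ?thesis
    using disjoint_paths_bundle rigid_linkage_bundle round_of_le[OF assms(4)]
    unfolding path_bundle_def disjoint_paths_def by blast
qed

end
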